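(* Let $n\ge 1$, $l=\lfloor n/2\rfloor$, and let $x,y\in\mathbb{C}$. Let $J_n$ be an $n\times n$ complex irreducible tridiagonal matrix with zero main diagonal, with subdiagonal entries $a_1,\dots,a_{n-1}\in\mathbb{C}\setminus\{0\}$ and superdiagonal entries $c_1,\dots,c_{n-1}\in\mathbb{C}\setminus\{0\}$. Let $B_n$ be the tridiagonal matrix with the same sub- and superdiagonals as $J_n$ and with main diagonal entries $b_k=x$ for odd $k$ and $b_k=y$ for even $k$, $k=1,\dots,n$. Let $\lambda_1,\dots,\lambda_l\in\mathbb{C}$ be such that, as multisets (eigenvalues listed with algebraic multiplicity), $\sigma(J_n)=\{\pm\lambda_1,\dots,\pm\lambda_l\}$ if $n=2l$, and $\sigma(J_n)=\{0,\pm\lambda_1,\dots,\pm\lambda_l\}$ if $n=2l+1$. Then, as multisets (eigenvalues listed with algebraic multiplicity), $$\sigma(B_{2l})=\left\{\frac{x+y}2\pm\frac12\sqrt{4\lambda_1^2+(x-y)^2},\ \ldots,\ \frac{x+y}2\pm\frac12\sqrt{4\lambda_l^2+(x-y)^2}\right\}\quad\text{if } n=2l,$$ and $$\sigma(B_{2l+1})=\left\{x,\ \frac{x+y}2\pm\frac12\sqrt{4\lambda_1^2+(x-y)^2},\ \ldots,\ \frac{x+y}2\pm\frac12\sqrt{4\lambda_l^2+(x-y)^2}\right\}\quad\text{if } n=2l+1.$$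
   Context: $J_n$ has entries $(J_n)_{k+1,k}=a_k$, $(J_n)_{k,k+1}=c_k$ for $k=1,\dots,n-1$, and all other entries zero. The spectrum $\sigma(M)$ of a matrix $M$ is the multiset of its eigenvalues, each appearing as many times as its algebraic multiplicity. The spectrum of $J_n$ always admits the listing used in the claim (it is symmetric with respect to $0$); the numbers $\lambda_i$ need not be distinct, and for odd $n$ some of them may be zero. The symbol $\pm\sqrt{w}$ stands for the two complex square roots of $w$ (the value $0$ taken twice if $w=0$). *)

theory Defs
  imports Complex_Main "HOL-Library.Multiset" "Jordan_Normal_Form.Char_Poly"
begin

(* The sequences a (subdiagonal), b (diagonal) and c (superdiagonal) are indexed from 1,
   whereas matrix positions in Jordan_Normal_Form are indexed from 0. *)
definition tridiag_mat ::
  "nat \<Rightarrow> (nat \<Rightarrow> complex) \<Rightarrow> (nat \<Rightarrow> complex) \<Rightarrow> (nat \<Rightarrow> complex) \<Rightarrow> complex mat" where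
  "tridiag_mat n a b c = mat n n (\<lambda>(i, j).
     if i = j then b (i + 1)
     else if i = j + 1 then a (j + 1)
     else if j = i + 1 then c (i + 1)
     else 0)"

definition J_mat :: "nat \<Rightarrow> (nat \<Rightarrow> complex) \<Rightarrow> (nat \<Rightarrow> complex) \<Rightarrow> complex mat" where
  "J_mat n a c = tridiag_mat n a (\<lambda>k. 0) c"

definition B_mat ::
  "nat \<Rightarrow> complex \<Rightarrow> complex \<Rightarrow> (nat \<Rightarrow> complex) \<Rightarrow> (nat \<Rightarrow> complex) \<Rightarrow> complex mat" where
  "B_mat n x y a c = tridiag_mat n a (\<lambda>k. if odd k then x else y) c"

definition spectrum_mset :: "complex mat \<Rightarrow> complex multiset" where
  "spectrum_mset A = proots (char_poly A)"

lemma char_poly_nonzero: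
  fixes A :: "complex mat"
  assumes "A \<in> carrier_mat n n"
  shows "char_poly A \<noteq> 0"
  using degree_monic_char_poly[OF assms] by auto

lemma count_spectrum_mset:
  assumes "A \<in> carrier_mat n n"
  shows "count (spectrum_mset A) z = order z (char_poly A)"
  using char_poly_nonzero[OF assms] by (simp add: spectrum_mset_def)

lemma set_spectrum_mset:
  assumes "A \<in> carrier_mat n n"
  shows "set_mset (spectrum_mset A) = {z. eigenvalue A z}"
  using char_poly_nonzero[OF assms] eigenvalue_root_char_poly[OF assms]
  by (simp add: spectrum_mset_def)

end

theory Submission
  imports Defs
begin

(* Expanding along the last row gives the characteristic polynomials of the leading submatrices a
   three-term recurrence. With diagonal x, y, x, y, ... it follows that the characteristic
   polynomial is q((X - x) (X - y)) for even n and (X - x) r((X - x) (X - y)) for odd n, where q and r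
   depend only on the products a_k c_k. The case x = y = 0 is J_n, so its spectrum
   determines q (resp. r) as the product of the T - lambda_i^2, and
   (X - x) (X - y) - lambda_i^2 is then factored by the quadratic formula. *)

text \<open>In the Laplace expansion along the last row only the last two entries can be nonzero.
  The minor of the off-diagonal one is again expanded, along its last column, where just one entry
  survives. Entries lie in an arbitrary commutative ring so that polynomial matrices are
  covered.\<close>

lemma det_tridiagonal_rec:
  fixes A :: "nat \<Rightarrow> nat \<Rightarrow> 'a :: comm_ring_1"
  assumes tri: "\<And>i j. i + 1 < j \<or> j + 1 < i \<Longrightarrow> A i j = 0"
  shows "det (mat (n + 2) (n + 2) (\<lambda>(i, j). A i j)) =
    A (n + 1) (n + 1) * det (mat (n + 1) (n + 1) (\<lambda>(i, j). A i j)) -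
    A (n + 1) n * A n (n + 1) * det (mat n n (\<lambda>(i, j). A i j))"
proof -
  define M where "M k = mat k k (\<lambda>(i, j). A i j)" for k
  define N where "N = mat_delete (M (n + 2)) (n + 1) n"
  have N: "N \<in> carrier_mat (n + 1) (n + 1)"
    by (auto simp: N_def M_def mat_delete_def)
  have "det N = (\<Sum>i<n + 1. N $$ (i, n) * cofactor N i n)"
    by (rule laplace_expansion_column[OF N]) simp
  also have "\<dots> = (\<Sum>i<n. N $$ (i, n) * cofactor N i n) + N $$ (n, n) * cofactor N n n"
    by simp
  \<comment> \<open>Deleting column \<open>n\<close> moves the old column \<open>n + 1\<close> into
    position \<open>n\<close>; its entries in rows above \<open>n\<close> lie outside the
    band.\<close>
  also have "(\<Sum>i<n. N $$ (i, n) * cofactor N i n) = 0"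
    by (rule sum.neutral) (auto simp: N_def M_def mat_delete_def tri)
  also have "N $$ (n, n) = A n (n + 1)"
    by (simp add: N_def M_def mat_delete_def)
  also have "cofactor N n n = det (M n)"
  proof -
    have "mat_delete N n n = M n"
      by (rule eq_matI) (auto simp: N_def M_def mat_delete_def)
    then show ?thesis
      by (simp add: cofactor_def)
  qed
  finally have detN: "det N = A n (n + 1) * det (M n)"
    by simp
  have "det (M (n + 2)) = (\<Sum>j<n + 2. M (n + 2) $$ (n + 1, j) * cofactor (M (n + 2)) (n + 1) j)"
    by (rule laplace_expansion_row) (auto simp: M_def)
  also have "\<dots> = (\<Sum>j<n. M (n + 2) $$ (n + 1, j) * cofactor (M (n + 2)) (n + 1) j) +
      M (n + 2) $$ (n + 1, n) * cofactor (M (n + 2)) (n + 1) n +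
      M (n + 2) $$ (n + 1, n + 1) * cofactor (M (n + 2)) (n + 1) (n + 1)"
    by simp
  also have "(\<Sum>j<n. M (n + 2) $$ (n + 1, j) * cofactor (M (n + 2)) (n + 1) j) = 0"
    by (rule sum.neutral) (auto simp: M_def tri)
  also have "M (n + 2) $$ (n + 1, n) = A (n + 1) n"
    by (simp add: M_def)
  also have "M (n + 2) $$ (n + 1, n + 1) = A (n + 1) (n + 1)"
    by (simp add: M_def)
  \<comment> \<open>The position has odd index sum \<open>2 * n + 1\<close>, which produces the
    minus sign of the recurrence.\<close>
  also have "cofactor (M (n + 2)) (n + 1) n = - det N"
    by (simp add: cofactor_def N_def flip: mult_2)
  also have "cofactor (M (n + 2)) (n + 1) (n + 1) = det (M (n + 1))"
  proof -
    have "mat_delete (M (n + 2)) (n + 1) (n + 1) = M (n + 1)"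
      by (rule eq_matI) (auto simp: M_def mat_delete_def)
    then show ?thesis
      by (simp add: cofactor_def flip: mult_2)
  qed
  finally show ?thesis
    by (simp add: detN M_def algebra_simps)
qed

lemma char_poly_tridiag_mat:
  "char_poly (tridiag_mat n a b c) = det (mat n n (\<lambda>(i, j).
     if i = j then [:- b (i + 1), 1:]
     else if i = j + 1 then [:- a (j + 1):]
     else if j = i + 1 then [:- c (i + 1):]
     else 0))"
  unfolding char_poly_def char_poly_matrix_def tridiag_mat_def
  by (intro arg_cong[of _ _ det] eq_matI) auto

lemma char_poly_tridiag_mat_0: "char_poly (tridiag_mat 0 a b c) = 1"
  by (simp add: char_poly_tridiag_mat)

lemma char_poly_tridiag_mat_1: "char_poly (tridiag_mat 1 a b c) = [:- b 1, 1:]"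
  unfolding char_poly_tridiag_mat by (subst det_single) auto

text \<open>The characteristic matrix is itself tridiagonal over the polynomial ring. Its
  off-diagonal entries are negated, but the two signs cancel in the product.\<close>

lemma char_poly_tridiag_mat_rec:
  "char_poly (tridiag_mat (n + 2) a b c) =
    [:- b (n + 2), 1:] * char_poly (tridiag_mat (n + 1) a b c) -
    Polynomial.smult (a (n + 1) * c (n + 1)) (char_poly (tridiag_mat n a b c))"
  unfolding char_poly_tridiag_mat
  by (subst det_tridiagonal_rec) auto

text \<open>The quantifier order matters: \<open>q\<close> and \<open>r\<close> are chosen before
  \<open>x\<close> and \<open>y\<close>, so information gained at one pair \<open>x\<close>,
  \<open>y\<close> transfers to all others. Both parities are carried through one induction because
  the recurrence reaches back two sizes.\<close>

lemma char_poly_B_mat: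
  "\<exists>q r. \<forall>x y.
    char_poly (B_mat (2 * m) x y a c) = pcompose q ([:- x, 1:] * [:- y, 1:]) \<and>
    char_poly (B_mat (2 * m + 1) x y a c) = [:- x, 1:] * pcompose r ([:- x, 1:] * [:- y, 1:])"
proof (induction m)
  case 0
  show ?case
    unfolding B_mat_def
    by (rule exI[of _ 1], rule exI[of _ 1])
      (simp add: char_poly_tridiag_mat_0 char_poly_tridiag_mat_1[simplified])
next
  case (Suc m)
  then obtain q r where
    q: "\<And>x y. char_poly (B_mat (2 * m) x y a c) = pcompose q ([:- x, 1:] * [:- y, 1:])" and
    r: "\<And>x y. char_poly (B_mat (2 * m + 1) x y a c) =
      [:- x, 1:] * pcompose r ([:- x, 1:] * [:- y, 1:])"
    by blast
  define d where "d k = a k * c k" for k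
  \<comment> \<open>With P = (X - x) (X - y), the new diagonal entry y contributes (X - y) (X - x)
    r(P) = P r(P), hence the factor \<open>[:0, 1:]\<close> in front of \<open>r\<close>.\<close>
  define q' where "q' = [:0, 1:] * r - Polynomial.smult (d (2 * m + 1)) q"
  \<comment> \<open>Here the new diagonal entry is x, so both terms of the recurrence share the
    factor X - x, which is pulled out.\<close>
  define r' where "r' = q' - Polynomial.smult (d (2 * m + 2)) r"
  have q': "char_poly (B_mat (2 * m + 2) x y a c) = pcompose q' ([:- x, 1:] * [:- y, 1:])" for x y
  proof -
    have "char_poly (B_mat (2 * m + 2) x y a c) =
        [:- y, 1:] * char_poly (B_mat (2 * m + 1) x y a c) -
        Polynomial.smult (d (2 * m + 1)) (char_poly (B_mat (2 * m) x y a c))"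
      using char_poly_tridiag_mat_rec[of "2 * m" a "\<lambda>k. if odd k then x else y" c]
      by (simp add: B_mat_def d_def)
    also have "\<dots> = pcompose q' ([:- x, 1:] * [:- y, 1:])"
    proof -
      have "pcompose [:0, 1:] p = p" for p :: "complex poly"
        by (simp add: pcompose_pCons)
      then show ?thesis
        unfolding q r q'_def pcompose_diff pcompose_mult pcompose_smult
        by (simp only: mult_ac)
    qed
    finally show ?thesis .
  qed
  have r': "char_poly (B_mat (2 * m + 3) x y a c) =
      [:- x, 1:] * pcompose r' ([:- x, 1:] * [:- y, 1:])" for x y
  proof -
    have "char_poly (B_mat (2 * m + 3) x y a c) =
        [:- x, 1:] * char_poly (B_mat (2 * m + 2) x y a c) -
        Polynomial.smult (d (2 * m + 2)) (char_poly (B_mat (2 * m + 1) x y a c))"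
      using char_poly_tridiag_mat_rec[of "2 * m + 1" a "\<lambda>k. if odd k then x else y" c]
      by (simp add: B_mat_def d_def numeral_3_eq_3)
    also have "\<dots> = [:- x, 1:] * pcompose r' ([:- x, 1:] * [:- y, 1:])"
      unfolding q' r r'_def pcompose_diff pcompose_smult
      by (simp only: right_diff_distrib mult_smult_right)
    finally show ?thesis .
  qed
  show ?case
    using q' r' by (intro exI[of _ q'] exI[of _ r']) (simp add: numeral_3_eq_3)
qed

lemma J_mat_eq_B_mat: "J_mat n a c = B_mat n 0 0 a c"
  by (simp add: J_mat_def B_mat_def)

text \<open>The characteristic polynomial is monic and splits over the complex numbers, so its roots
  with multiplicity recover it exactly.\<close>

lemma char_poly_eq_prod_spectrum_mset:
  assumes "A \<in> carrier_mat n n"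
  shows "char_poly A = (\<Prod>z\<in>#spectrum_mset A. [:- z, 1:])"
  using complex_poly_decompose_multiset[of "char_poly A"] degree_monic_char_poly[OF assms]
  by (simp add: spectrum_mset_def)

lemma J_mat_carrier: "J_mat n a c \<in> carrier_mat n n"
  by (simp add: J_mat_def tridiag_mat_def)

lemma prod_mset_sum_pairs:
  fixes f :: "'a \<Rightarrow> 'b :: comm_monoid_mult"
  assumes "finite I"
  shows "(\<Prod>z\<in>#(\<Sum>i\<in>I. {#u i, v i#}). f z) = (\<Prod>i\<in>I. f (u i) * f (v i))"
  using assms by (induction I) (auto simp: mult.assoc)

text \<open>Composition is additive in its left argument, and a nonzero polynomial stays nonzero
  when composed with a nonconstant one.\<close>

lemma pcompose_inject:
  fixes p q s :: "'a :: idom poly"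
  assumes "pcompose p s = pcompose q s" "degree s > 0"
  shows "p = q"
proof -
  have "pcompose (p - q) s = 0"
    using assms(1) by (simp add: pcompose_diff)
  then have "p - q = 0"
    using assms(2) by (rule pcompose_eq_0)
  then show ?thesis
    by simp
qed

text \<open>Each pair of factors is X^2 - lam^2, that is, T - lam^2 at T = X^2; the substitution of
  X^2 can then be cancelled.\<close>

lemma pcompose_square_eq_prod:
  fixes p :: "complex poly" and lam :: "'i \<Rightarrow> complex"
  assumes "pcompose p ([:0, 1:] * [:0, 1:]) = (\<Prod>i\<in>I. [:- lam i, 1:] * [:lam i, 1:])"
  shows "p = (\<Prod>i\<in>I. [:- (lam i)\<^sup>2, 1:])"
proof (rule pcompose_inject)
  show "pcompose p ([:0, 1:] * [:0, 1:]) =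
      pcompose (\<Prod>i\<in>I. [:- (lam i)\<^sup>2, 1:]) ([:0, 1:] * [:0, 1:])"
    unfolding assms pcompose_prod
    by (intro prod.cong) (simp_all add: pcompose_pCons power2_eq_square)
qed simp

text \<open>The quadratic (X - x) (X - y) - lam^2 has root sum x + y and discriminant 4 lam^2 + (x -
  y)^2. Both signs of the root appear, so the branch chosen by \<open>csqrt\<close> does not affect
  the multiset.\<close>

lemma proots_pcompose_prod:
  fixes lam :: "'i \<Rightarrow> complex" and x y :: complex
  assumes "finite I"
  defines "w \<equiv> \<lambda>i. csqrt (4 * (lam i)\<^sup>2 + (x - y)\<^sup>2)"
  shows "proots (pcompose (\<Prod>i\<in>I. [:- (lam i)\<^sup>2, 1:]) ([:- x, 1:] * [:- y, 1:])) =
    (\<Sum>i\<in>I. {#(x + y) / 2 + 1 / 2 * w i, (x + y) / 2 - 1 / 2 * w i#})"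
proof -
  have factor: "pcompose [:- (lam i)\<^sup>2, 1:] ([:- x, 1:] * [:- y, 1:]) =
      [:- ((x + y) / 2 + 1 / 2 * w i), 1:] * [:- ((x + y) / 2 - 1 / 2 * w i), 1:]" for i
  proof -
    \<comment> \<open>Eliminating lam in favour of \<open>w i\<close> makes the factorization a
      plain polynomial identity, free of square roots.\<close>
    have "(lam i)\<^sup>2 = ((w i)\<^sup>2 - (x - y)\<^sup>2) / 4"
      by (simp add: w_def)
    then have "pcompose [:- (lam i)\<^sup>2, 1:] ([:- x, 1:] * [:- y, 1:]) =
        pcompose [:- (((w i)\<^sup>2 - (x - y)\<^sup>2) / 4), 1:] ([:- x, 1:] * [:- y, 1:])"
      by (simp only:)
    also have "\<dots> =
        [:- ((x + y) / 2 + 1 / 2 * w i), 1:] * [:- ((x + y) / 2 - 1 / 2 * w i), 1:]"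
      by (simp add: pcompose_pCons field_simps power2_eq_square)
    finally show ?thesis .
  qed
  have pair: "proots ([:- u, 1:] * [:- v, 1:]) = {#u, v#}" for u v :: complex
    by (subst proots_mult) (simp_all add: add_mset_commute)
  show ?thesis
    unfolding pcompose_prod factor
    by (subst proots_prod) (simp_all only: pair mult_eq_0_iff pCons_eq_0_iff, simp_all)
qed

theorem mainTheorem2:
  fixes n l :: nat
    and x y :: complex
    and a c lam :: "nat \<Rightarrow> complex"
  assumes n: "n \<ge> 1"
    and l: "l = n div 2"
    and a: "\<forall>k\<in>{1..n - 1}. a k \<noteq> 0"
    and c: "\<forall>k\<in>{1..n - 1}. c k \<noteq> 0"
    and J_even: "n = 2 * l \<longrightarrow>
      spectrum_mset (J_mat n a c) = (\<Sum>i\<in>{1..l}. {#lam i, - lam i#})"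
    and J_odd: "n = 2 * l + 1 \<longrightarrow>
      spectrum_mset (J_mat n a c) = {#0#} + (\<Sum>i\<in>{1..l}. {#lam i, - lam i#})"
  shows "(n = 2 * l \<longrightarrow>
      spectrum_mset (B_mat n x y a c) =
        (\<Sum>i\<in>{1..l}.
          {#(x + y) / 2 + 1 / 2 * csqrt (4 * (lam i)\<^sup>2 + (x - y)\<^sup>2),
            (x + y) / 2 - 1 / 2 * csqrt (4 * (lam i)\<^sup>2 + (x - y)\<^sup>2)#})) \<and>
    (n = 2 * l + 1 \<longrightarrow>
      spectrum_mset (B_mat n x y a c) =
        {#x#} + (\<Sum>i\<in>{1..l}.
          {#(x + y) / 2 + 1 / 2 * csqrt (4 * (lam i)\<^sup>2 + (x - y)\<^sup>2),
            (x + y) / 2 - 1 / 2 * csqrt (4 * (lam i)\<^sup>2 + (x - y)\<^sup>2)#}))"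
proof -
  let ?P = "[:- x, 1:] * [:- y, 1:]"
  obtain q r where
    q: "\<And>x y. char_poly (B_mat (2 * l) x y a c) = pcompose q ([:- x, 1:] * [:- y, 1:])" and
    r: "\<And>x y. char_poly (B_mat (2 * l + 1) x y a c) =
      [:- x, 1:] * pcompose r ([:- x, 1:] * [:- y, 1:])"
    using char_poly_B_mat[of l a c] by blast
  have pairs: "(\<Prod>z\<in>#(\<Sum>i\<in>{1..l}. {#lam i, - lam i#}). [:- z, 1:]) =
      (\<Prod>i\<in>{1..l}. [:- lam i, 1:] * [:lam i, 1:])"
    by (simp add: prod_mset_sum_pairs del: mult_pCons_left mult_pCons_right)
  note J_factors = char_poly_eq_prod_spectrum_mset[OF J_mat_carrier, of n a c]
  show ?thesis
  proof (intro conjI impI)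
    assume even: "n = 2 * l"
    \<comment> \<open>Two expressions for the characteristic polynomial of
      \<open>J_mat n a c\<close> are equated: \<open>q\<close> at x = y = 0, and the product over
      the given spectrum.\<close>
    have "pcompose q ([:0, 1:] * [:0, 1:]) = (\<Prod>i\<in>{1..l}. [:- lam i, 1:] * [:lam i, 1:])"
      using J_factors J_even even q[of 0 0] by (simp only: pairs J_mat_eq_B_mat minus_zero simp_thms)
    then have "q = (\<Prod>i\<in>{1..l}. [:- (lam i)\<^sup>2, 1:])"
      by (rule pcompose_square_eq_prod)
    then show "spectrum_mset (B_mat n x y a c) =
        (\<Sum>i\<in>{1..l}.
          {#(x + y) / 2 + 1 / 2 * csqrt (4 * (lam i)\<^sup>2 + (x - y)\<^sup>2),
            (x + y) / 2 - 1 / 2 * csqrt (4 * (lam i)\<^sup>2 + (x - y)\<^sup>2)#})"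
      unfolding even spectrum_mset_def q by (simp only: proots_pcompose_prod finite_atLeastAtMost)
  next
    assume odd: "n = 2 * l + 1"
    \<comment> \<open>For odd size the eigenvalue 0 supplies a factor X that matches X - x at x = 0;
      it is cancelled next.\<close>
    have "[:0, 1:] * pcompose r ([:0, 1:] * [:0, 1:]) =
        [:0, 1:] * (\<Prod>i\<in>{1..l}. [:- lam i, 1:] * [:lam i, 1:])"
      using J_factors J_odd odd r[of 0 0]
      by (simp only: image_mset_union prod_mset_Un image_mset_single prod_mset_singleton
          pairs J_mat_eq_B_mat minus_zero simp_thms)
    then have "pcompose r ([:0, 1:] * [:0, 1:]) = (\<Prod>i\<in>{1..l}. [:- lam i, 1:] * [:lam i, 1:])"
      by (rule mult_left_cancel[THEN iffD1, rotated]) simp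
    then have r_eq: "r = (\<Prod>i\<in>{1..l}. [:- (lam i)\<^sup>2, 1:])"
      by (rule pcompose_square_eq_prod)
    \<comment> \<open>The root multiset of a product is the sum of those of the factors provided the
      product is nonzero.\<close>
    have "char_poly (B_mat n x y a c) \<noteq> 0"
      by (rule char_poly_nonzero[of _ n]) (simp add: B_mat_def tridiag_mat_def)
    then have nz: "[:- x, 1:] \<noteq> 0" "pcompose r ?P \<noteq> 0"
      unfolding odd r by (simp_all only: mult_eq_0_iff de_Morgan_disj simp_thms)
    show "spectrum_mset (B_mat n x y a c) =
        {#x#} + (\<Sum>i\<in>{1..l}.
          {#(x + y) / 2 + 1 / 2 * csqrt (4 * (lam i)\<^sup>2 + (x - y)\<^sup>2),
            (x + y) / 2 - 1 / 2 * csqrt (4 * (lam i)\<^sup>2 + (x - y)\<^sup>2)#})"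
      unfolding odd spectrum_mset_def r proots_mult[OF nz] unfolding r_eq
      by (simp only: proots_linear_factor minus_minus proots_pcompose_prod finite_atLeastAtMost)
  qed
qed

end
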